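(* Consider the following non-clairvoyant policy for scheduling precedence-constrained jobs on a single machine: at time $0$ and at each of the first $n-1$ job completion times $t$, compute processing rates by Algorithm 1 (described in the context) and keep these rates constant until the next job completion. This policy is $2$-competitive for minimizing the total weighted completion time, i.e., for every instance, the schedule $\mathrm{ALG}$ it produces satisfies $\sum_{j=1}^n w_j C_j^{\mathrm{ALG}} \le 2 \sum_{j=1}^n w_j C_j^{\mathrm{OPT}}$, where $\mathrm{OPT}$ is an optimal schedule for the instance computed with full knowledge of all processing times.
   Context: An instance consists of jobs $N=\{1,\dots,n\}$ with processing times $p_j\ge 0$, weights $w_j\ge 0$, and precedence constraints $A\subseteq N\times N$ such that $(N,A)$ is a directed acyclic graph; $(k,j)\in A$ means $k$ must be completed before $j$ can be processed. A (preemptive, single-machine) schedule assigns to each job $j$ at every time $t\ge 0$ a processing rate $R_j(t)\in[0,1]$ with $\sum_j R_j(t)\le 1$, where only available jobs may receive positive rate; a job is available at time $t$ if it is not yet completed but all its predecessors are. The elapsed processing time is $Y_j(t)=\int_0^t R_j(s)\,ds$ and the completion time is $C_j=\min\{t\ge 0: Y_j(t)\ge p_j\}$. The objective is $\sum_j w_j C_j$. Non-clairvoyant: weights and precedence constraints are known from the start, but $p_j$ is only revealed when job $j$ completes. For $j\in N$ let $S(j)$ be the set consisting of $j$ and all nodes reachable from $j$ in $(N,A)$. At time $t$ let $U_t=\{j: C_j>t\}$ be the unfinished jobs and $F_t\subseteq U_t$ the available jobs; for $J\subseteq N$ write $w(J)=\sum_{j\in J}w_j$. Algorithm 1 (rates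 at time $t$): set $U'\gets U_t$; for each $i\in F_t$ in turn (in an arbitrary order), set $T(i)\gets S(i)\cap U'$ and $U'\gets U'\setminus T(i)$; then process each $i\in F_t$ at rate $R_i(t)=w(T(i))/w(U_t)$. *)

theory Defs
  imports "HOL-Analysis.Analysis"
begin

definition sched_instance ::
  "nat \<Rightarrow> (nat \<Rightarrow> real) \<Rightarrow> (nat \<Rightarrow> real) \<Rightarrow> (nat \<times> nat) set \<Rightarrow> bool" where
  "sched_instance n p w A \<longleftrightarrow>
     (\<forall>j\<in>{1..n}. 0 \<le> p j) \<and> (\<forall>j\<in>{1..n}. 0 \<le> w j) \<and>
     A \<subseteq> {1..n} \<times> {1..n} \<and> acyclic A"

definition reachable_from :: "(nat \<times> nat) set \<Rightarrow> nat \<Rightarrow> nat set" where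
  "reachable_from A j = {k. (j, k) \<in> A\<^sup>*}"

definition elapsed :: "(nat \<Rightarrow> real \<Rightarrow> real) \<Rightarrow> nat \<Rightarrow> real \<Rightarrow> real" where
  "elapsed R j t = integral {0..t} (R j)"

text \<open>
  The infimum is \<open>\<infinity>\<close> if the job is never completed, and otherwise it is a minimum
  (lemma \<open>completion_time_attained\<close>).
\<close>

definition completion_time ::
  "(nat \<Rightarrow> real) \<Rightarrow> (nat \<Rightarrow> real \<Rightarrow> real) \<Rightarrow> nat \<Rightarrow> ereal" where
  "completion_time p R j = Inf {ereal t | t. 0 \<le> t \<and> p j \<le> elapsed R j t}"

definition unfinished ::
  "nat \<Rightarrow> (nat \<Rightarrow> real) \<Rightarrow> (nat \<Rightarrow> real \<Rightarrow> real) \<Rightarrow> real \<Rightarrow> nat set" where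
  "unfinished n p R t = {j \<in> {1..n}. ereal t < completion_time p R j}"

text \<open>
  The predecessors of \<open>j\<close> are all nodes from which \<open>j\<close> can be reached, not only its direct
  predecessors. The two readings differ only in the presence of jobs with processing time 0:
  such a job has completion time 0 even if its own predecessors are unfinished, and must not
  release its successors.
\<close>

definition available ::
  "nat \<Rightarrow> (nat \<Rightarrow> real) \<Rightarrow> (nat \<times> nat) set \<Rightarrow> (nat \<Rightarrow> real \<Rightarrow> real) \<Rightarrow> real \<Rightarrow> nat set" where
  "available n p A R t =
     {j \<in> unfinished n p R t. \<forall>k. (k, j) \<in> A\<^sup>+ \<longrightarrow> completion_time p R k \<le> ereal t}"

definition schedule ::
  "nat \<Rightarrow> (nat \<Rightarrow> real) \<Rightarrow> (nat \<times> nat) set \<Rightarrow> (nat \<Rightarrow> real \<Rightarrow> real) \<Rightarrow> bool" where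
  "schedule n p A R \<longleftrightarrow>
     (\<forall>j\<in>{1..n}. \<forall>t\<ge>0. R j integrable_on {0..t}) \<and>
     (\<forall>j\<in>{1..n}. \<forall>t\<ge>0. 0 \<le> R j t \<and> R j t \<le> 1) \<and>
     (\<forall>t\<ge>0. (\<Sum>j=1..n. R j t) \<le> 1) \<and>
     (\<forall>j\<in>{1..n}. \<forall>t\<ge>0. 0 < R j t \<longrightarrow> j \<in> available n p A R t)"

text \<open>
  In \<open>ereal\<close> we have \<open>0 * \<infinity> = 0\<close>: the cost is finite iff all jobs of positive weight
  are completed.
\<close>

definition cost ::
  "nat \<Rightarrow> (nat \<Rightarrow> real) \<Rightarrow> (nat \<Rightarrow> real) \<Rightarrow> (nat \<Rightarrow> real \<Rightarrow> real) \<Rightarrow> ereal" where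
  "cost n p w R = (\<Sum>j=1..n. ereal (w j) * completion_time p R j)"

definition optimal_schedule ::
  "nat \<Rightarrow> (nat \<Rightarrow> real) \<Rightarrow> (nat \<Rightarrow> real) \<Rightarrow> (nat \<times> nat) set \<Rightarrow> (nat \<Rightarrow> real \<Rightarrow> real) \<Rightarrow> bool" where
  "optimal_schedule n p w A R \<longleftrightarrow>
     schedule n p A R \<and> (\<forall>R'. schedule n p A R' \<longrightarrow> cost n p w R \<le> cost n p w R')"

text \<open>
  \<open>assigned A is U' i\<close> is the set \<open>T(i)\<close> computed by the loop over the available jobs in the
  order \<open>is\<close>, started with the set \<open>U'\<close>.
\<close>

fun assigned :: "(nat \<times> nat) set \<Rightarrow> nat list \<Rightarrow> nat set \<Rightarrow> nat \<Rightarrow> nat set" where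
  "assigned A [] U' i = {}"
| "assigned A (k # ks) U' i =
     (let T = reachable_from A k \<inter> U'
      in if i = k then T else assigned A ks (U' - T) i)"

text \<open>
  At each decision time \<open>\<tau>\<close> an order \<open>is\<close> of the available jobs is chosen, and the resulting
  rates are kept at all \<open>t \<ge> \<tau>\<close> up to the next completion time (exclusively), that is, as long
  as the set of unfinished jobs is the same as at time \<open>\<tau>\<close>. If all unfinished jobs have weight 0,
  then the rate \<open>w(T(i)) / w(U)\<close> is undefined; from then on the rates are left unrestricted.
\<close>

definition follows_policy ::
  "nat \<Rightarrow> (nat \<Rightarrow> real) \<Rightarrow> (nat \<Rightarrow> real) \<Rightarrow> (nat \<times> nat) set \<Rightarrow> (nat \<Rightarrow> real \<Rightarrow> real) \<Rightarrow> bool" where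
  "follows_policy n p w A R \<longleftrightarrow>
     (\<forall>\<tau>. (\<tau> = 0 \<or> (\<exists>k\<in>{1..n}. completion_time p R k = ereal \<tau>)) \<and>
          0 < sum w (unfinished n p R \<tau>) \<longrightarrow>
        (\<exists>is. distinct is \<and> set is = available n p A R \<tau> \<and>
           (\<forall>t\<ge>\<tau>. unfinished n p R t = unfinished n p R \<tau> \<longrightarrow>
              (\<forall>i\<in>available n p A R \<tau>.
                 R i t = sum w (assigned A is (unfinished n p R \<tau>) i)
                           / sum w (unfinished n p R \<tau>)))))"

lemma completion_time_attained:
  assumes R: "schedule n p A R" and j: "j \<in> {1..n}"
    and ex: "0 \<le> s" "p j \<le> elapsed R j s"
  shows "\<exists>t. completion_time p R j = ereal t \<and> 0 \<le> t \<and> p j \<le> elapsed R j t"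
proof -
  define X where "X = {t \<in> {0..s}. p j \<le> elapsed R j t}"
  have "R j integrable_on {0..s}"
    using R j ex(1) by (simp add: schedule_def)
  then have "continuous_on {0..s} (elapsed R j)"
    unfolding elapsed_def[abs_def] by (rule indefinite_integral_continuous_1)
  then have "closed X"
    unfolding X_def
    by (intro continuous_on_closed_Collect_le continuous_on_const closed_atLeastAtMost)
  moreover have "bounded X"
    by (rule bounded_subset[of "{0..s}"]) (auto simp: X_def)
  ultimately have "compact X"
    by (simp add: compact_eq_bounded_closed)
  moreover have "X \<noteq> {}" using ex by (auto simp: X_def)
  ultimately obtain t where t: "t \<in> X" "\<And>u. u \<in> X \<Longrightarrow> t \<le> u"
    using compact_attains_inf[of X] by blast
  have "t \<le> u" if "0 \<le> u" "p j \<le> elapsed R j u" for u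
    using t that by (cases "u \<le> s") (auto simp: X_def)
  then have "completion_time p R j = ereal t"
    unfolding completion_time_def using t(1)
    by (intro Inf_eqI) (auto simp: X_def)
  then show ?thesis using t(1) by (auto simp: X_def)
qed

end

theory Submission imports Defs begin

text \<open>
  Write \<open>C\<close> for the completion times in the optimal schedule and \<open>U\<close> for the set of jobs left
  unfinished by the policy at time \<open>t\<close>. Symmetrizing the double sum gives
  \<open>w(U)\<^sup>2 \<le> 2 \<Sum>k\<in>U. w\<^sub>k w(U \<inter> J\<^sub>k)\<close> with \<open>J\<^sub>k = {j. C\<^sub>j \<le> C\<^sub>k}\<close>. The policy
  spends rate at least \<open>w(U \<inter> J\<^sub>k) / w(U)\<close> on the set \<open>I\<^sub>k\<close> of ancestors of \<open>J\<^sub>k\<close>, so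
  \<open>w(U) \<le> 2 \<Sum>k. w\<^sub>k (rate spent on I\<^sub>k at time t)\<close>. Integrating over \<open>t\<close>, the left side becomes
  the cost of the policy, and the right side is at most \<open>2 \<Sum>k. w\<^sub>k p(I\<^sub>k)\<close>. Finally
  \<open>p(I\<^sub>k) \<le> C\<^sub>k\<close>, since the optimal schedule has completed all of \<open>I\<^sub>k\<close> by time \<open>C\<^sub>k\<close>.
\<close>

section \<open>Completion times and elapsed processing in an arbitrary schedule\<close>

lemma completion_time_nonneg: "0 \<le> completion_time p R j"
  unfolding completion_time_def by (rule Inf_greatest) auto

lemma completion_time_le: "0 \<le> t \<Longrightarrow> p j \<le> elapsed R j t \<Longrightarrow> completion_time p R j \<le> ereal t"
  unfolding completion_time_def by (rule Inf_lower) auto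

lemma finite_completion_time:
  assumes "schedule n p A R" and "j \<in> {1..n}" and C: "completion_time p R j = ereal c"
  shows "0 \<le> c" and "p j \<le> elapsed R j c"
proof -
  have "{ereal t | t. 0 \<le> t \<and> p j \<le> elapsed R j t} \<noteq> {}"
    using C unfolding completion_time_def by (metis Inf_empty PInfty_neq_ereal(1) top_ereal_def)
  then obtain s where "0 \<le> s" "p j \<le> elapsed R j s" by auto
  from completion_time_attained[OF assms(1,2) this] C
  show "0 \<le> c" and "p j \<le> elapsed R j c" by auto
qed

text \<open>Nothing has elapsed at time 0, so a job with \<open>p j \<le> 0\<close> counts as
  completed from the start.\<close>

lemma unfinished_pos:
  assumes "j \<in> unfinished n p R t" and "0 \<le> t"
  shows "0 < p j"
proof (rule ccontr)
  assume "\<not> 0 < p j"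
  then have "completion_time p R j \<le> ereal 0"
    by (intro completion_time_le) (auto simp: elapsed_def)
  then show False
    using assms by (auto simp: unfinished_def dest: less_le_trans)
qed

lemma integrable_on_rate:
  assumes "schedule n p A R" and "j \<in> {1..n}" and "0 \<le> s"
  shows "R j integrable_on {s..t}"
proof (cases "s \<le> t")
  case True
  then have "R j integrable_on {0..t}"
    using assms by (simp add: schedule_def)
  then show ?thesis
    by (rule integrable_on_subinterval) (use assms in auto)
qed auto

lemma rate_nonneg: "schedule n p A R \<Longrightarrow> j \<in> {1..n} \<Longrightarrow> 0 \<le> t \<Longrightarrow> 0 \<le> R j t"
  by (simp add: schedule_def)

lemma available_if_rate_pos:
  "schedule n p A R \<Longrightarrow> j \<in> {1..n} \<Longrightarrow> 0 \<le> t \<Longrightarrow> 0 < R j t \<Longrightarrow> j \<in> available n p A R t"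
  by (simp add: schedule_def)

lemma elapsed_diff:
  assumes "schedule n p A R" and "j \<in> {1..n}" and "0 \<le> s" and "s \<le> t"
  shows "elapsed R j t = elapsed R j s + integral {s..t} (R j)"
  unfolding elapsed_def
  using Henstock_Kurzweil_Integration.integral_combine[of 0 s t "R j"]
    integrable_on_rate[of n p A R j 0 t] assms by simp

lemma elapsed_mono:
  assumes "schedule n p A R" and "j \<in> {1..n}" and "0 \<le> s" and "s \<le> t"
  shows "elapsed R j s \<le> elapsed R j t"
proof -
  have "0 \<le> integral {s..t} (R j)"
    using assms by (intro integral_nonneg integrable_on_rate[OF assms(1,2)]) (auto simp: schedule_def)
  then show ?thesis using elapsed_diff[OF assms] by simp
qed

lemma elapsed_le_processing_time:
  assumes R: "schedule n p A R" and j: "j \<in> {1..n}" and "0 \<le> p j" and "0 \<le> t"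
  shows "elapsed R j t \<le> p j"
proof (rule ccontr)
  assume *: "\<not> elapsed R j t \<le> p j"
  have "continuous_on {0..t} (elapsed R j)"
    unfolding elapsed_def[abs_def]
    using integrable_on_rate[OF R j order.refl] by (rule indefinite_integral_continuous_1)
  moreover have "elapsed R j 0 \<le> p j" using assms by (simp add: elapsed_def)
  ultimately obtain s where s: "0 \<le> s" "s \<le> t" "elapsed R j s = p j"
    using IVT'[of "elapsed R j" 0 "p j" t] * \<open>0 \<le> t\<close> by auto
  then have C: "completion_time p R j \<le> ereal s" by (intro completion_time_le) auto
  have "R j u = 0" if "u \<in> {s..t}" for u
  proof -
    have "completion_time p R j \<le> ereal u" using C that order_trans by fastforce
    then have "j \<notin> available n p A R u"
      by (simp add: available_def unfinished_def not_less)
    moreover have "0 \<le> u" using that s by simp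
    ultimately show ?thesis
      using rate_nonneg[OF R j] available_if_rate_pos[OF R j] by (metis order_le_less)
  qed
  then have "integral {s..t} (R j) = 0"
    by (intro integral_unique has_integral_is_0)
  with elapsed_diff[OF R j s(1,2)] s(3) * show False by simp
qed

lemma sum_elapsed_le:
  assumes R: "schedule n p A R" and I: "I \<subseteq> {1..n}" and t: "0 \<le> t"
  shows "(\<Sum>i\<in>I. elapsed R i t) \<le> t"
proof -
  have fin: "finite I" using I finite_subset by blast
  have int: "R i integrable_on {0..t}" if "i \<in> I" for i
    using integrable_on_rate[OF R] I that by blast
  have "(\<Sum>i\<in>I. elapsed R i t) = integral {0..t} (\<lambda>s. \<Sum>i\<in>I. R i s)"
    unfolding elapsed_def using fin int by (simp add: integral_sum)
  also have "\<dots> \<le> integral {0..t} (\<lambda>s. 1)"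
  proof (rule integral_le)
    fix s assume s: "s \<in> {0..t}"
    have "(\<Sum>i\<in>I. R i s) \<le> (\<Sum>i=1..n. R i s)"
      using I R s by (intro sum_mono2) (auto simp: schedule_def)
    also have "\<dots> \<le> 1" using R s by (simp add: schedule_def)
    finally show "(\<Sum>i\<in>I. R i s) \<le> 1" .
  qed (use fin int integrable_sum in auto)
  finally show ?thesis using t by simp
qed

text \<open>To accumulate \<open>p j > 0\<close> by time \<open>c\<close>, job \<open>j\<close> must
  have positive rate at some moment up to \<open>c\<close>. It is available at that moment, so its
  proper ancestors are completed. With \<open>p j = 0\<close> there need be no such moment.\<close>

lemma completion_time_ancestor_le:
  assumes R: "schedule n p A R" and j: "j \<in> {1..n}" and p: "0 < p j"
    and ij: "(i, j) \<in> A\<^sup>*" and C: "completion_time p R j = ereal c"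
  shows "completion_time p R i \<le> ereal c"
proof (cases "i = j")
  case False
  then have ij: "(i, j) \<in> A\<^sup>+" using ij by (simp add: rtrancl_eq_or_trancl)
  note c = finite_completion_time[OF R j C]
  have "\<exists>s\<in>{0..c}. 0 < R j s"
  proof (rule ccontr)
    assume "\<not> ?thesis"
    then have "R j s = 0" if "s \<in> {0..c}" for s
      using rate_nonneg[OF R j, of s] that by (simp add: not_less order_antisym)
    then have "elapsed R j c = 0"
      unfolding elapsed_def by (intro integral_unique has_integral_is_0)
    then show False using c p by simp
  qed
  then obtain s where s: "0 \<le> s" "s \<le> c" "0 < R j s" by auto
  then have "completion_time p R i \<le> ereal s"
    using available_if_rate_pos[OF R j] ij by (simp add: available_def)
  then show ?thesis using s order_trans by fastforce
qed (use C in simp)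

text \<open>By time \<open>c\<close> every job of \<open>I\<close> has received its full processing
  time, and a machine of unit speed does at most \<open>c\<close> units of work by then.\<close>

lemma sum_processing_time_le:
  assumes R: "schedule n p A R" and I: "I \<subseteq> {1..n}" and "0 \<le> c"
    and C: "\<And>i. i \<in> I \<Longrightarrow> completion_time p R i \<le> ereal c"
  shows "sum p I \<le> c"
proof -
  have "p i \<le> elapsed R i c" if i: "i \<in> I" for i
  proof -
    obtain c' where c': "completion_time p R i = ereal c'"
      using C[OF i] completion_time_nonneg[of p R i] by (cases "completion_time p R i") auto
    have iN: "i \<in> {1..n}" using i I by blast
    have "p i \<le> elapsed R i c'" "0 \<le> c'" using finite_completion_time[OF R iN c'] by auto
    moreover have "c' \<le> c" using C[OF i] c' by simp
    ultimately show ?thesis using elapsed_mono[OF R iN] by force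
  qed
  then have "sum p I \<le> (\<Sum>i\<in>I. elapsed R i c)" by (rule sum_mono)
  also have "\<dots> \<le> c" using sum_elapsed_le[OF R I \<open>0 \<le> c\<close>] .
  finally show ?thesis .
qed

section \<open>Rates prescribed by the policy\<close>

text \<open>Since \<open>A\<close> is finite and acyclic, \<open>j\<close> has a minimal unfinished
  ancestor, possibly itself. All proper ancestors of that one are completed, so it is
  available.\<close>

lemma unfinished_reachable_from_available:
  assumes A: "A \<subseteq> {1..n} \<times> {1..n}" "acyclic A" and j: "j \<in> unfinished n p R t"
  obtains i where "i \<in> available n p A R t" and "(i, j) \<in> A\<^sup>*"
proof -
  have "finite A" using A(1) by (rule finite_subset) simp
  then have "wf (A\<^sup>+)" using A(2) by (simp add: finite_acyclic_wf wf_trancl)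
  moreover have "j \<in> {i \<in> unfinished n p R t. (i, j) \<in> A\<^sup>*}" using j by simp
  ultimately obtain i where i: "i \<in> unfinished n p R t" "(i, j) \<in> A\<^sup>*"
    and min: "\<And>k. (k, i) \<in> A\<^sup>+ \<Longrightarrow> k \<notin> {i \<in> unfinished n p R t. (i, j) \<in> A\<^sup>*}"
    by (rule wfE_min) auto
  have "completion_time p R k \<le> ereal t" if k: "(k, i) \<in> A\<^sup>+" for k
  proof -
    have "(k, j) \<in> A\<^sup>*" using k i(2) by (meson rtrancl_trans trancl_into_rtrancl)
    moreover have "k \<in> {1..n}"
      using k trancl_subset_Sigma[OF A(1)] by auto
    ultimately show ?thesis using min[OF k] by (auto simp: unfinished_def)
  qed
  then have "i \<in> available n p A R t" using i(1) by (auto simp: available_def)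
  then show thesis using that i(2) by blast
qed

lemma assigned_subset: "assigned A is U i \<subseteq> U \<inter> reachable_from A i"
  by (induction "is" arbitrary: U) (auto simp: Let_def)

text \<open>The loop hands \<open>j\<close> to the first list element from which it is reachable;
  the earlier ones leave it in the remaining set.\<close>

lemma ex_assigned:
  "j \<in> U \<Longrightarrow> k \<in> set is \<Longrightarrow> j \<in> reachable_from A k \<Longrightarrow> \<exists>i\<in>set is. j \<in> assigned A is U i"
proof (induction "is" arbitrary: U)
  case (Cons l ls)
  show ?case
  proof (cases "j \<in> reachable_from A l")
    case False
    then have "\<exists>i\<in>set ls. j \<in> assigned A ls (U - reachable_from A l \<inter> U) i"
      using Cons by (intro Cons.IH) auto
    \<comment> \<open>The witness \<open>i\<close> in \<open>ls\<close> differs from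
      \<open>l\<close>, because \<open>j\<close> is reachable from \<open>i\<close> but not from
      \<open>l\<close>. So the loop over the whole list returns the same set for
      \<open>i\<close>.\<close>
    then show ?thesis using assigned_subset False by (fastforce simp: Let_def)
  qed (use Cons.prems in \<open>auto simp: Let_def\<close>)
qed simp

text \<open>Rates are prescribed relative to decision times. The latest one up to \<open>t\<close>
  serves, since the unfinished and the available jobs are the same then as at
  \<open>t\<close>.\<close>

lemma policy_rates:
  assumes A: "A \<subseteq> {1..n} \<times> {1..n}" and P: "follows_policy n p w A R"
    and t: "0 \<le> t" and pos: "0 < sum w (unfinished n p R t)"
  obtains "is" where "set is = available n p A R t"
    and "\<And>i. i \<in> available n p A R t \<Longrightarrow>
           R i t = sum w (assigned A is (unfinished n p R t) i) / sum w (unfinished n p R t)"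
proof -
  define X where
    "X = insert 0 {s. s \<le> t \<and> (\<exists>k\<in>{1..n}. completion_time p R k = ereal s)}"
  have "X \<subseteq> insert 0 ((\<lambda>k. real_of_ereal (completion_time p R k)) ` {1..n})"
    by (force simp: X_def)
  then have fin: "finite X" by (rule finite_subset) simp
  define \<tau> where "\<tau> = Max X"
  have \<tau>: "\<tau> \<in> X" using fin Max_in[of X] by (auto simp: \<tau>_def X_def)
  have "\<tau> \<le> t" using \<tau> t by (auto simp: X_def)
  \<comment> \<open>A completion after \<open>\<tau>\<close> and up to \<open>t\<close> would be an
    element of \<open>X\<close> beyond its maximum.\<close>
  have same: "completion_time p R k \<le> ereal t \<longleftrightarrow> completion_time p R k \<le> ereal \<tau>"
    if k: "k \<in> {1..n}" for k
  proof
    assume *: "completion_time p R k \<le> ereal t"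
    then obtain s where s: "completion_time p R k = ereal s"
      using completion_time_nonneg[of p R k] by (cases "completion_time p R k") auto
    then have "s \<in> X" using k * by (auto simp: X_def)
    then show "completion_time p R k \<le> ereal \<tau>" using fin s by (simp add: \<tau>_def)
  qed (use \<open>\<tau> \<le> t\<close> order_trans in fastforce)
  have U: "unfinished n p R t = unfinished n p R \<tau>"
    using same by (auto simp: unfinished_def not_le[symmetric])
  \<comment> \<open>The definition of \<open>available\<close> quantifies over all \<open>k\<close>,
    whereas \<open>same\<close> covers only jobs.\<close>
  have "k \<in> {1..n}" if "(k, j) \<in> A\<^sup>+" for k j
    using that trancl_subset_Sigma[OF A] by auto
  then have F: "available n p A R t = available n p A R \<tau>"
    using same unfolding available_def U by blast
  have "\<tau> = 0 \<or> (\<exists>k\<in>{1..n}. completion_time p R k = ereal \<tau>)"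
    using \<tau> by (auto simp: X_def)
  with P pos obtain "is" where "set is = available n p A R \<tau>" and
    "\<forall>t\<ge>\<tau>. unfinished n p R t = unfinished n p R \<tau> \<longrightarrow>
       (\<forall>i\<in>available n p A R \<tau>.
          R i t = sum w (assigned A is (unfinished n p R \<tau>) i) / sum w (unfinished n p R \<tau>))"
    unfolding follows_policy_def U by blast
  then show thesis using that[of "is"] \<open>\<tau> \<le> t\<close> U F by simp
qed

text \<open>Inclusion-exclusion with the nonnegative intersection term dropped. It bounds the weight
  of a union of assigned sets by the sum of the weights that determine the rates.\<close>

lemma sum_UN_le:
  fixes f :: "'a \<Rightarrow> 'b::ordered_ab_group_add"
  assumes "finite I" and "\<And>i. i \<in> I \<Longrightarrow> finite (B i)"
    and "\<And>i x. i \<in> I \<Longrightarrow> x \<in> B i \<Longrightarrow> 0 \<le> f x"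
  shows "sum f (\<Union>i\<in>I. B i) \<le> (\<Sum>i\<in>I. sum f (B i))"
  using assms
proof (induction I rule: finite_induct)
  case (insert i I)
  have nonneg: "0 \<le> sum f (B i \<inter> (\<Union>i\<in>I. B i))"
    using insert.prems(2) by (intro sum_nonneg) blast
  have "sum f (\<Union>i\<in>insert i I. B i) = sum f (B i) + sum f (\<Union>i\<in>I. B i) - sum f (B i \<inter> (\<Union>i\<in>I. B i))"
    using insert by (simp add: sum_Un)
  also have "\<dots> \<le> sum f (B i) + sum f (\<Union>i\<in>I. B i)"
    using nonneg by simp
  also have "sum f (\<Union>i\<in>I. B i) \<le> (\<Sum>i\<in>I. sum f (B i))"
    using insert.prems by (intro insert.IH) blast+
  also have "sum f (B i) + (\<Sum>i\<in>I. sum f (B i)) = (\<Sum>i\<in>insert i I. sum f (B i))"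
    using insert.hyps by simp
  finally show ?case by simp
qed simp

text \<open>Each unfinished \<open>j\<close> in \<open>J\<close> is assigned to some available
  ancestor \<open>i\<close>, and \<open>p j > 0\<close> as \<open>j\<close> is unfinished. So the
  assigned sets of those \<open>i\<close> cover \<open>U \<inter> J\<close>, and their weights
  divided by \<open>w(U)\<close> are the rates.\<close>

lemma policy_rate_ancestors_ge:
  assumes inst: "sched_instance n p w A" and R: "schedule n p A R"
    and P: "follows_policy n p w A R" and t: "0 \<le> t"
    and pos: "0 < sum w (unfinished n p R t)"
  defines "U \<equiv> unfinished n p R t"
  shows "sum w (U \<inter> J) / sum w U
    \<le> (\<Sum>i\<in>{i \<in> {1..n}. \<exists>j\<in>J. 0 < p j \<and> (i, j) \<in> A\<^sup>*}. R i t)"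
    (is "_ \<le> sum _ ?I")
proof -
  have A: "A \<subseteq> {1..n} \<times> {1..n}" "acyclic A" and w: "\<And>j. j \<in> {1..n} \<Longrightarrow> 0 \<le> w j"
    using inst by (auto simp: sched_instance_def)
  obtain "is" where set_is: "set is = available n p A R t"
    and rate: "\<And>i. i \<in> available n p A R t \<Longrightarrow> R i t = sum w (assigned A is U i) / sum w U"
    using policy_rates[OF A(1) P t pos] unfolding U_def by blast
  have UN: "U \<subseteq> {1..n}" by (auto simp: U_def unfinished_def)
  have wU: "0 \<le> w j" if "j \<in> U" for j using w UN that by blast
  have TU: "assigned A is U i \<subseteq> U" for i using assigned_subset by blast
  have finU: "finite U" using UN finite_subset by blast
  have "U \<inter> J \<subseteq> (\<Union>i\<in>set is \<inter> ?I. assigned A is U i)"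
  proof
    fix j assume j: "j \<in> U \<inter> J"
    then obtain k where "k \<in> set is" "(k, j) \<in> A\<^sup>*"
      using unfinished_reachable_from_available[OF A] set_is unfolding U_def by blast
    then obtain i where i: "i \<in> set is" "j \<in> assigned A is U i"
      using ex_assigned[of j U k "is" A] j by (auto simp: reachable_from_def)
    then have "(i, j) \<in> A\<^sup>*" using assigned_subset by (fastforce simp: reachable_from_def)
    moreover have "0 < p j" using j unfinished_pos t unfolding U_def by blast
    moreover have "i \<in> {1..n}" using i set_is by (auto simp: available_def unfinished_def)
    ultimately show "j \<in> (\<Union>i\<in>set is \<inter> ?I. assigned A is U i)" using i j by blast
  qed
  then have "sum w (U \<inter> J) \<le> sum w (\<Union>i\<in>set is \<inter> ?I. assigned A is U i)"
    using TU finU by (intro sum_mono2 finite_UN_I finite_Int finite_subset[OF TU finU] wU) auto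
  also have "\<dots> \<le> (\<Sum>i\<in>set is \<inter> ?I. sum w (assigned A is U i))"
    using TU wU finite_subset[OF TU finU] by (intro sum_UN_le) auto
  finally have "sum w (U \<inter> J) / sum w U \<le> (\<Sum>i\<in>set is \<inter> ?I. sum w (assigned A is U i)) / sum w U"
    using pos by (simp add: U_def divide_right_mono)
  also have "\<dots> = (\<Sum>i\<in>set is \<inter> ?I. R i t)"
    by (subst sum_divide_distrib) (use rate set_is in \<open>auto intro: sum.cong\<close>)
  also have "\<dots> \<le> (\<Sum>i\<in>?I. R i t)"
    using R t by (intro sum_mono2) (auto simp: schedule_def)
  finally show ?thesis .
qed

section \<open>Weights of ordered pairs, and costs as integrals over time\<close>

text \<open>In a linear order each pair satisfies \<open>C j \<le> C k\<close> or
  \<open>C k \<le> C j\<close>, so \<open>w k * w j\<close> is at most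
  \<open>?f k j + ?f j k\<close>. Both summands have the same total.\<close>

lemma sum_squared_le_twice_ordered_pairs:
  fixes w :: "'a \<Rightarrow> real" and C :: "'a \<Rightarrow> 'b::linorder"
  assumes "finite U" and "\<And>j. j \<in> U \<Longrightarrow> 0 \<le> w j"
  shows "(sum w U)\<^sup>2 \<le> 2 * (\<Sum>k\<in>U. w k * sum w (U \<inter> {j. C j \<le> C k}))"
proof -
  let ?f = "\<lambda>k j. w k * (if C j \<le> C k then w j else 0)"
  have f: "(\<Sum>k\<in>U. w k * sum w (U \<inter> {j. C j \<le> C k})) = (\<Sum>k\<in>U. \<Sum>j\<in>U. ?f k j)"
    unfolding sum_distrib_left[symmetric]
    using assms(1) by (simp add: sum.inter_restrict)
  have "(sum w U)\<^sup>2 = (\<Sum>k\<in>U. \<Sum>j\<in>U. w k * w j)"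
    by (simp add: power2_eq_square sum_product)
  also have "\<dots> \<le> (\<Sum>k\<in>U. \<Sum>j\<in>U. ?f k j + ?f j k)"
    using assms(2) by (intro sum_mono) (auto simp: mult.commute)
  also have "\<dots> = (\<Sum>k\<in>U. \<Sum>j\<in>U. ?f k j) + (\<Sum>k\<in>U. \<Sum>j\<in>U. ?f j k)"
    by (simp add: sum.distrib)
  also have "(\<Sum>k\<in>U. \<Sum>j\<in>U. ?f j k) = (\<Sum>k\<in>U. \<Sum>j\<in>U. ?f k j)"
    by (rule sum.swap)
  finally show ?thesis unfolding f by simp
qed

text \<open>A completion time is the integral of the indicator of not being completed. The horizon
  \<open>T\<close> keeps the integral finite when \<open>C\<close> is infinite.\<close>

lemma integral_before_completion:
  assumes T: "0 \<le> T"
  shows "((\<lambda>t. of_bool (ereal t < C)) :: real \<Rightarrow> real) integrable_on {0..T}"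
    and "C = \<infinity> \<Longrightarrow> integral {0..T} (\<lambda>t. of_bool (ereal t < C)) = T"
    and "C = ereal c \<Longrightarrow> 0 \<le> c \<Longrightarrow> c \<le> T \<Longrightarrow> integral {0..T} (\<lambda>t. of_bool (ereal t < C)) = c"
proof -
  have c: "((\<lambda>t. of_bool (ereal t < ereal c)) has_integral c) {0..T}" if "0 \<le> c" "c \<le> T" for c
  proof -
    have "((\<lambda>t. 1::real) has_integral c) {0..c}"
      using has_integral_const_real[of "1::real" 0 c] that by simp
    then have "((\<lambda>t. of_bool (ereal t < ereal c)) has_integral c) {0..c}"
      \<comment> \<open>On \<open>{0..c}\<close> the indicator differs from the constant 1 only at
        \<open>c\<close>.\<close>
      by (rule has_integral_spike_finite[of "{c}", rotated 2]) auto
    moreover have "((\<lambda>t. of_bool (ereal t < ereal c)) has_integral 0) {c..T}"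
      by (rule has_integral_is_0) auto
    ultimately show ?thesis
      using has_integral_combine[of 0 c T] that by fastforce
  qed
  have T1: "((\<lambda>t. of_bool (ereal t < C)) has_integral T) {0..T}" if "ereal T < C"
  proof (rule has_integral_eq)
    show "((\<lambda>t. 1::real) has_integral T) {0..T}"
      using has_integral_const_real[of "1::real" 0 T] T by simp
    show "1 = of_bool (ereal t < C)" if "t \<in> {0..T}" for t
      using that \<open>ereal T < C\<close> by (simp add: le_less_trans[of "ereal t" "ereal T" C])
  qed
  have T0: "((\<lambda>t. of_bool (ereal t < C)) has_integral (0::real)) {0..T}" if "C < 0"
  proof (rule has_integral_is_0)
    fix t assume "t \<in> {0..T}"
    then have "C < ereal t" using that by (simp add: less_le_trans)
    then show "of_bool (ereal t < C) = (0::real)" by simp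
  qed
  show "((\<lambda>t. of_bool (ereal t < C)) :: real \<Rightarrow> real) integrable_on {0..T}"
  proof (cases C)
    case (real r)
    then show ?thesis
      using c[of r] T1 T0 by (cases "r < 0"; cases "r \<le> T") (auto simp: has_integral_iff)
  qed (use T0 T1 in \<open>auto simp: has_integral_iff\<close>)
  show "C = \<infinity> \<Longrightarrow> integral {0..T} (\<lambda>t. of_bool (ereal t < C)) = T"
    using T1 by (simp add: has_integral_iff)
  show "C = ereal c \<Longrightarrow> 0 \<le> c \<Longrightarrow> c \<le> T \<Longrightarrow> integral {0..T} (\<lambda>t. of_bool (ereal t < C)) = c"
    using c by (simp add: has_integral_iff)
qed

text \<open>A job of positive weight that is never completed would contribute
  \<open>w j * T\<close>, which is unbounded in \<open>T\<close>. With none of these, one large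
  horizon already gives the exact cost.\<close>

lemma cost_le_of_truncated_costs_le:
  assumes w: "\<And>j. j \<in> {1..n} \<Longrightarrow> 0 \<le> w j"
    and B: "\<And>T. 0 \<le> T \<Longrightarrow>
      (\<Sum>j=1..n. w j * integral {0..T} (\<lambda>t. of_bool (ereal t < completion_time p R j))) \<le> B"
  shows "cost n p w R \<le> ereal B"
proof -
  let ?C = "completion_time p R"
  let ?m = "\<lambda>T j. integral {0..T} (\<lambda>t. of_bool (ereal t < ?C j)) :: real"
  have m0: "0 \<le> ?m T j" if "0 \<le> T" for T j
    using integral_before_completion(1)[OF that] by (intro integral_nonneg) auto
  have fin: "?C j \<noteq> \<infinity>" if j: "j \<in> {1..n}" "0 < w j" for j
  proof
    assume inf: "?C j = \<infinity>"
    \<comment> \<open>Chosen so that \<open>w j * T\<close> is \<open>\<bar>B\<bar> + 1\<close>,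
      which exceeds \<open>B\<close>.\<close>
    define T where "T = (\<bar>B\<bar> + 1) / w j"
    have T: "0 \<le> T" using j by (simp add: T_def)
    have "w j * ?m T j \<le> (\<Sum>j=1..n. w j * ?m T j)"
      using j(1) w m0[OF T] by (intro member_le_sum) auto
    also have "\<dots> \<le> B" by (rule B[OF T])
    finally show False
      using integral_before_completion(2)[OF T inf] j(2) by (simp add: T_def)
  qed
  define c where "c j = real_of_ereal (?C j)" for j
  \<comment> \<open>At least every finite completion time. Jobs never completed have
    \<open>c j = 0\<close> by the convention for \<open>real_of_ereal\<close>, and weight 0 by
    \<open>fin\<close>.\<close>
  define T where "T = (\<Sum>j=1..n. c j)"
  have c0: "0 \<le> c j" for j
    by (simp add: c_def completion_time_nonneg real_of_ereal_pos)
  then have T: "0 \<le> T" by (simp add: T_def sum_nonneg)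
  have "ereal (w j) * ?C j = ereal (w j * ?m T j)" if j: "j \<in> {1..n}" for j
  proof (cases "w j = 0")
    case False
    then have "?C j = ereal (c j)"
      using fin[OF j] w[OF j] completion_time_nonneg[of p R j]
      by (cases "?C j") (auto simp: c_def)
    moreover have "c j \<le> T" unfolding T_def using j c0 by (intro member_le_sum) auto
    ultimately show ?thesis using integral_before_completion(3)[OF T _ c0] by simp
  qed (simp add: zero_ereal_def[symmetric])
  then have "cost n p w R = ereal (\<Sum>j=1..n. w j * ?m T j)"
    unfolding cost_def by (simp flip: sum_ereal)
  then show ?thesis using B[OF T] by simp
qed

section \<open>Comparison with the optimal schedule\<close>

theorem theorem1:
  fixes n :: nat and p w :: "nat \<Rightarrow> real" and A :: "(nat \<times> nat) set"
    and ALG OPT :: "nat \<Rightarrow> real \<Rightarrow> real"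
  assumes "sched_instance n p w A"
    and "schedule n p A ALG" and "follows_policy n p w A ALG"
    and "optimal_schedule n p w A OPT"
  shows "cost n p w ALG \<le> 2 * cost n p w OPT"
proof -
  note inst = assms(1) and R = assms(2) and P = assms(3)
  have O: "schedule n p A OPT" using assms(4) by (simp add: optimal_schedule_def)
  have p: "\<And>j. j \<in> {1..n} \<Longrightarrow> 0 \<le> p j" and w: "\<And>j. j \<in> {1..n} \<Longrightarrow> 0 \<le> w j"
    using inst by (auto simp: sched_instance_def)
  let ?C = "completion_time p OPT"
  show ?thesis
  proof (cases "\<exists>j\<in>{1..n}. 0 < w j \<and> ?C j = \<infinity>")
    case True
    \<comment> \<open>Here the optimal cost is infinite and the bound is trivial.\<close>
    then obtain k where k: "k \<in> {1..n}" "0 < w k" "?C k = \<infinity>" by blast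
    then have "\<infinity> = ereal (w k) * ?C k" by simp
    also have "\<dots> = (\<Sum>j\<in>{k}. ereal (w j) * ?C j)" by simp
    also have "\<dots> \<le> cost n p w OPT"
      unfolding cost_def using k(1) w completion_time_nonneg[of p OPT]
      by (intro sum_mono2) auto
    finally show ?thesis by simp
  next
    case False
    define c where "c k = real_of_ereal (?C k)" for k
    have c: "?C k = ereal (c k)" if "k \<in> {1..n}" "0 < w k" for k
      using False that completion_time_nonneg[of p OPT k] by (cases "?C k") (auto simp: c_def)
    have "ereal (w k) * ?C k = ereal (w k * c k)" if k: "k \<in> {1..n}" for k
      using c[OF k] w[OF k] by (cases "w k = 0") (auto simp: zero_ereal_def[symmetric])
    then have cost: "cost n p w OPT = ereal (\<Sum>k=1..n. w k * c k)"
      unfolding cost_def by (simp flip: sum_ereal)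
    \<comment> \<open>Jobs with processing time 0 count as completed at time 0 even if their ancestors are not,
      so only the ancestors of jobs with positive processing time can be included.\<close>
    define I where
      "I k = {i \<in> {1..n}. \<exists>j\<in>{j \<in> {1..n}. ?C j \<le> ?C k}. 0 < p j \<and> (i, j) \<in> A\<^sup>*}" for k
    have IN: "I k \<subseteq> {1..n}" for k by (auto simp: I_def)
    have finI: "finite (I k)" for k using IN finite_subset by blast
    have volume: "sum p (I k) \<le> c k" if k: "k \<in> {1..n}" "0 < w k" for k
    proof (rule sum_processing_time_le[OF O IN])
      show "0 \<le> c k" by (simp add: c_def completion_time_nonneg real_of_ereal_pos)
      fix i assume "i \<in> I k"
      then obtain j where j: "j \<in> {1..n}" "?C j \<le> ?C k" "0 < p j" "(i, j) \<in> A\<^sup>*"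
        by (auto simp: I_def)
      \<comment> \<open>Job \<open>j\<close> may have weight 0; its completion time is finite
        because it is at most that of \<open>k\<close>.\<close>
      then obtain c' where c': "?C j = ereal c'"
        using c[OF k] completion_time_nonneg[of p OPT j] by (cases "?C j") auto
      from completion_time_ancestor_le[OF O j(1,3,4) c'] show "?C i \<le> ereal (c k)"
        using c' j(2) c[OF k] by (auto intro: order_trans)
    qed
    let ?b = "\<lambda>j t. of_bool (ereal t < completion_time p ALG j) :: real"
    have pointwise: "(\<Sum>j=1..n. w j * ?b j t) \<le> 2 * (\<Sum>k=1..n. w k * (\<Sum>i\<in>I k. ALG i t))"
      if t: "0 \<le> t" for t
    proof -
      define U where "U = unfinished n p ALG t"
      have UN: "U \<subseteq> {1..n}" by (auto simp: U_def unfinished_def)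
      then have finU: "finite U" using finite_subset by blast
      have wU: "(\<Sum>j=1..n. w j * ?b j t) = sum w U"
        unfolding U_def unfinished_def
        by (subst sum.inter_filter) (auto simp: of_bool_def simp del: sum.If_cases intro!: sum.cong)
      have rate0: "0 \<le> (\<Sum>i\<in>I k. ALG i t)" for k
        using rate_nonneg[OF R _ t] IN by (intro sum_nonneg) blast
      show ?thesis
      proof (cases "0 < sum w U")
        case True
        let ?J = "\<lambda>k. {j \<in> {1..n}. ?C j \<le> ?C k}"
        have J: "U \<inter> {j. ?C j \<le> ?C k} = U \<inter> ?J k" for k using UN by blast
        have rate: "sum w (U \<inter> ?J k) / sum w U \<le> (\<Sum>i\<in>I k. ALG i t)" for k
          using policy_rate_ancestors_ge[OF inst R P t, of "?J k"] True
          unfolding U_def I_def by blast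
        have "(sum w U)\<^sup>2 \<le> 2 * (\<Sum>k\<in>U. w k * sum w (U \<inter> ?J k))"
          using sum_squared_le_twice_ordered_pairs[OF finU, of w ?C] w UN unfolding J by blast
        then have "sum w U \<le> 2 * (\<Sum>k\<in>U. w k * sum w (U \<inter> ?J k)) / sum w U"
          using True by (simp add: field_simps power2_eq_square)
        also have "\<dots> = 2 * (\<Sum>k\<in>U. w k * (sum w (U \<inter> ?J k) / sum w U))"
          by (simp only: times_divide_eq_right flip: sum_divide_distrib)
        also have "\<dots> \<le> 2 * (\<Sum>k\<in>U. w k * (\<Sum>i\<in>I k. ALG i t))"
          using rate w UN by (intro mult_left_mono sum_mono) auto
        also have "\<dots> \<le> 2 * (\<Sum>k=1..n. w k * (\<Sum>i\<in>I k. ALG i t))"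
          using UN w rate0 by (intro mult_left_mono sum_mono2) auto
        finally show ?thesis using wU by simp
      next
        case False
        \<comment> \<open>No rates are prescribed when the unfinished jobs have total weight 0, but
          then the left side is 0.\<close>
        have "0 \<le> (\<Sum>k=1..n. w k * (\<Sum>i\<in>I k. ALG i t))"
          using w by (intro sum_nonneg mult_nonneg_nonneg[OF _ rate0]) blast
        with False wU show ?thesis by linarith
      qed
    qed
    have "cost n p w ALG \<le> ereal (2 * (\<Sum>k=1..n. w k * c k))"
    proof (rule cost_le_of_truncated_costs_le[OF w])
      fix T :: real assume T: "0 \<le> T"
      note b_int = integral_before_completion(1)[OF T]
      have ALG_int: "ALG i integrable_on {0..T}" if "i \<in> I k" for i k
        using integrable_on_rate[OF R] IN that by blast
      have "(\<Sum>j=1..n. w j * integral {0..T} (?b j))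
          = integral {0..T} (\<lambda>t. \<Sum>j=1..n. w j * ?b j t)"
        using b_int by (subst integral_sum) (auto intro!: integrable_on_mult_right)
      also have "\<dots> \<le> integral {0..T} (\<lambda>t. 2 * (\<Sum>k=1..n. w k * (\<Sum>i\<in>I k. ALG i t)))"
        using pointwise b_int ALG_int finI
        by (intro integral_le integrable_sum integrable_on_mult_right) auto
      also have "\<dots> = 2 * (\<Sum>k=1..n. w k * (\<Sum>i\<in>I k. elapsed ALG i T))"
        using ALG_int finI
        by (simp add: integral_sum integrable_sum integrable_on_mult_right elapsed_def)
      also have "\<dots> \<le> 2 * (\<Sum>k=1..n. w k * c k)"
      proof (rule mult_left_mono[OF sum_mono])
        fix k assume k: "k \<in> {1..n}"
        have "(\<Sum>i\<in>I k. elapsed ALG i T) \<le> sum p (I k)"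
          using elapsed_le_processing_time[OF R _ p T] IN by (intro sum_mono) blast
        \<comment> \<open>For \<open>w k = 0\<close> both sides vanish; \<open>volume\<close> covers
          only positive weights, since \<open>c k\<close> is a mere default when \<open>?C k\<close>
          is infinite.\<close>
        then show "w k * (\<Sum>i\<in>I k. elapsed ALG i T) \<le> w k * c k"
          using volume[OF k] w[OF k] by (cases "w k = 0") (auto intro: mult_left_mono)
      qed simp
      finally show "(\<Sum>j=1..n. w j * integral {0..T} (?b j)) \<le> 2 * (\<Sum>k=1..n. w k * c k)" .
    qed
    then show ?thesis by (simp add: cost)
  qed
qed

end
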